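(* Let $q$ be a prime power, let $V$ be a quasiprojective variety defined over $\mathbb{F}_q$, and let $\phi:V\to V$ be an endomorphism of $V$ defined over $\mathbb{F}_q$. Let $G$ be a finite (not necessarily abelian) subgroup of $\operatorname{Aut}_{\mathbb{F}_q}(V)$ such that $\phi$ commutes with every element of $G$. Let $(n_H)_{H\le G}$ be integers indexed by the subgroups $H$ of $G$. If $\sum_{H\le G}n_H\varepsilon_H\sim 0$, then $$\sum_{H\le G}n_H\,\bigl|\operatorname{Per}_{\phi_H}(V/H)(\mathbb{F}_q)\bigr|=0.$$
   Context: For a subgroup $H\le G$, $\varepsilon_H:=|H|^{-1}\sum_{h\in H}h\in\mathbb{Q}[G]$. For $\alpha\in\mathbb{Q}[G]$, we write $\alpha\sim 0$ if $\psi(\alpha)=0$ for every rational character $\psi$ of $G$ (characters extended $\mathbb{Q}$-linearly to $\mathbb{Q}[G]$). For $H\le G$, $V/H$ is the quotient variety with projection $\pi_H:V\to V/H$ and $\phi_H:V/H\to V/H$ is the induced morphism with $\phi_H\circ\pi_H=\pi_H\circ\phi$. $\operatorname{Per}_{\phi_H}(V/H)(\mathbb{F}_q)$ is the set of points $P\in(V/H)(\mathbb{F}_q)$ with $\phi_H^n(P)=P$ for some $n\ge1$. *)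

theory Defs
  imports
    "HOL-Algebra.Algebraic_Closure_Type"
    "HOL-Algebra.Bij"
    "HOL-Library.Poly_Mapping"
    "Jordan_Normal_Form.Matrix"
begin

section \<open>Quasiprojective varieties over a field\<close>

text \<open>
  A variety over \<open>k\<close> is represented by its set of points over the algebraic closure of \<open>k\<close>,
  cut out by polynomials with coefficients in \<open>k\<close>. The base field is the type \<open>'f\<close>; below it
  is only assumed to be a field, and the finite field with \<open>q\<close> elements is a type of class
  \<open>finite_field\<close> (with \<open>q = CARD('f)\<close>). Open sets, morphisms and regular functions are all
  taken over \<open>k\<close>, i.e. they are those of the \<open>k\<close>-scheme.
\<close>

text \<open>Polynomials over \<open>'f\<close> in the variables \<open>X_0, X_1, ...\<close>: finitely supported functions
  from exponent vectors to coefficients.\<close>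

type_synonym 'f mpol = "(nat \<Rightarrow>\<^sub>0 nat) \<Rightarrow>\<^sub>0 'f"

definition mpol_eval :: "'f::field mpol \<Rightarrow> (nat \<Rightarrow> 'f alg_closure) \<Rightarrow> 'f alg_closure" where
  "mpol_eval P x =
     (\<Sum>m\<in>Poly_Mapping.keys P. to_ac (Poly_Mapping.lookup P m) *
        (\<Prod>i\<in>Poly_Mapping.keys m. x i ^ Poly_Mapping.lookup m i))"

text \<open>Forms of degree \<open>d\<close> in \<open>X_0, ..., X_N\<close>; the zero polynomial is a form of every degree.\<close>

definition is_form :: "nat \<Rightarrow> nat \<Rightarrow> 'f::zero mpol \<Rightarrow> bool" where
  "is_form N d P \<longleftrightarrow>
     (\<forall>m\<in>Poly_Mapping.keys P.
        Poly_Mapping.keys m \<subseteq> {..N} \<and> (\<Sum>i\<in>Poly_Mapping.keys m. Poly_Mapping.lookup m i) = d)"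

text \<open>A point of projective \<open>N\<close>-space is the set of all its homogeneous coordinate vectors;
  coordinates with index above \<open>N\<close> are 0.\<close>

type_synonym 'f proj_point = "(nat \<Rightarrow> 'f alg_closure) set"

definition proj_pt :: "(nat \<Rightarrow> 'f::field alg_closure) \<Rightarrow> 'f proj_point" where
  "proj_pt x = {(\<lambda>i. c * x i) | c. c \<noteq> 0}"

definition proj_space :: "nat \<Rightarrow> 'f::field proj_point set" where
  "proj_space N = {proj_pt x | x. (\<forall>i>N. x i = 0) \<and> (\<exists>i\<le>N. x i \<noteq> 0)}"

definition zariski_closed :: "nat \<Rightarrow> 'f::field proj_point set \<Rightarrow> bool" where
  "zariski_closed N Z \<longleftrightarrow>
     (\<exists>S. (\<forall>P\<in>S. \<exists>d. is_form N d P) \<and>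
          Z = {p \<in> proj_space N. \<forall>P\<in>S. \<forall>x\<in>p. mpol_eval P x = 0})"

definition quasiprojective :: "nat \<Rightarrow> 'f::field proj_point set \<Rightarrow> bool" where
  "quasiprojective N V \<longleftrightarrow> (\<exists>Z Y. zariski_closed N Z \<and> zariski_closed N Y \<and> V = Z - Y)"

definition zariski_open_in ::
    "nat \<Rightarrow> 'f::field proj_point set \<Rightarrow> 'f proj_point set \<Rightarrow> bool" where
  "zariski_open_in N V U \<longleftrightarrow> (\<exists>Y. zariski_closed N Y \<and> U = V - Y)"

text \<open>Morphisms over \<open>'f\<close> from \<open>V\<close> in \<open>N\<close>-space to \<open>W\<close> in \<open>M\<close>-space: locally given by
  \<open>M + 1\<close> forms of equal degree over \<open>'f\<close> without common zero. Values outside \<open>V\<close> are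
  irrelevant.\<close>

definition is_morphism ::
    "nat \<Rightarrow> 'f::field proj_point set \<Rightarrow> nat \<Rightarrow> 'f proj_point set \<Rightarrow>
     ('f proj_point \<Rightarrow> 'f proj_point) \<Rightarrow> bool" where
  "is_morphism N V M W f \<longleftrightarrow>
     f ` V \<subseteq> W \<and>
     (\<forall>p\<in>V. \<exists>U d F. zariski_open_in N V U \<and> p \<in> U \<and>
        (\<forall>j\<le>M. is_form N d (F j)) \<and>
        (\<forall>r\<in>U. \<forall>x\<in>r. (\<exists>j\<le>M. mpol_eval (F j) x \<noteq> 0) \<and>
           f r = proj_pt (\<lambda>j. if j \<le> M then mpol_eval (F j) x else 0)))"

definition regular_fun ::
    "nat \<Rightarrow> 'f::field proj_point set \<Rightarrow> ('f proj_point \<Rightarrow> 'f alg_closure) \<Rightarrow> bool" where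
  "regular_fun N V f \<longleftrightarrow>
     (\<forall>p\<in>V. \<exists>U d P Q. zariski_open_in N V U \<and> p \<in> U \<and> is_form N d P \<and> is_form N d Q \<and>
        (\<forall>r\<in>U. \<forall>x\<in>r. mpol_eval Q x \<noteq> 0 \<and> f r = mpol_eval P x / mpol_eval Q x))"

text \<open>The set of \<open>'f\<close>-rational points of \<open>V\<close>.\<close>

definition rational_points :: "'f::field proj_point set \<Rightarrow> 'f proj_point set" where
  "rational_points V = {p \<in> V. \<exists>x\<in>p. range x \<subseteq> range to_ac}"

definition aut_group ::
    "nat \<Rightarrow> 'f::field proj_point set \<Rightarrow> ('f proj_point \<Rightarrow> 'f proj_point) monoid" where
  "aut_group N V = BijGroup V
     \<lparr>carrier := {g \<in> Bij V. is_morphism N V N V g \<and> is_morphism N V N V (inv_into V g)}\<rparr>"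

section \<open>Quotient varieties\<close>

text \<open>
  \<open>(W, \<pi>)\<close> is the quotient variety \<open>V/H\<close>: its points are the \<open>H\<close>-orbits, it carries the quotient
  topology, and its regular functions are the \<open>H\<close>-invariant regular functions on \<open>V\<close>. These
  conditions determine \<open>(W, \<pi>)\<close> up to unique isomorphism over \<open>'f\<close>; for finite \<open>H\<close> and
  quasiprojective \<open>V\<close> such a quasiprojective \<open>W\<close> exists.
\<close>

definition is_quotient ::
    "nat \<Rightarrow> 'f::field proj_point set \<Rightarrow> ('f proj_point \<Rightarrow> 'f proj_point) set \<Rightarrow>
     nat \<Rightarrow> 'f proj_point set \<Rightarrow> ('f proj_point \<Rightarrow> 'f proj_point) \<Rightarrow> bool" where
  "is_quotient N V H M W \<pi> \<longleftrightarrow>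
     quasiprojective M W \<and>
     is_morphism N V M W \<pi> \<and>
     \<pi> ` V = W \<and>
     (\<forall>x\<in>V. \<forall>y\<in>V. \<pi> x = \<pi> y \<longleftrightarrow> (\<exists>h\<in>H. y = h x)) \<and>
     (\<forall>U\<subseteq>W. zariski_open_in M W U \<longleftrightarrow> zariski_open_in N V {x \<in> V. \<pi> x \<in> U}) \<and>
     (\<forall>U f. zariski_open_in M W U \<longrightarrow>
        (regular_fun M U f \<longleftrightarrow> regular_fun N {x \<in> V. \<pi> x \<in> U} (\<lambda>x. f (\<pi> x))))"

definition periodic_points :: "('a \<Rightarrow> 'a) \<Rightarrow> 'a set \<Rightarrow> 'a set" where
  "periodic_points f A = {p \<in> A. \<exists>n\<ge>1. (f ^^ n) p = p}"

section \<open>The rational group algebra and rational characters\<close>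

text \<open>Elements of the rational group algebra of a finite group \<open>G\<close> are functions
  from \<open>carrier G\<close> to the rationals (values elsewhere are irrelevant).\<close>

definition subgroup_idem :: "'g set \<Rightarrow> 'g \<Rightarrow> rat" where
  "subgroup_idem H = (\<lambda>g. if g \<in> H then 1 / of_nat (card H) else 0)"

text \<open>Characters of finite-dimensional matrix representations over the rationals.\<close>

definition rational_character :: "('g, 'b) monoid_scheme \<Rightarrow> ('g \<Rightarrow> rat) \<Rightarrow> bool" where
  "rational_character G \<psi> \<longleftrightarrow>
     (\<exists>d (\<rho> :: 'g \<Rightarrow> rat mat).
        (\<forall>g\<in>carrier G. \<rho> g \<in> carrier_mat d d) \<and>
        \<rho> \<one>\<^bsub>G\<^esub> = 1\<^sub>m d \<and>
        (\<forall>g\<in>carrier G. \<forall>h\<in>carrier G. \<rho> (g \<otimes>\<^bsub>G\<^esub> h) = \<rho> g * \<rho> h) \<and>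
        (\<forall>g\<in>carrier G. \<psi> g = (\<Sum>i<d. \<rho> g $$ (i, i))))"

definition char_equiv_zero :: "('g, 'b) monoid_scheme \<Rightarrow> ('g \<Rightarrow> rat) \<Rightarrow> bool" where
  "char_equiv_zero G \<alpha> \<longleftrightarrow>
     (\<forall>\<psi>. rational_character G \<psi> \<longrightarrow> (\<Sum>g\<in>carrier G. \<alpha> g * \<psi> g) = 0)"

end

theory Submission
  imports
    Defs
    "HOL-Algebra.Left_Coset"
    "HOL-Algebra.Group_Action"
    "HOL-Library.Cardinality"
begin

text \<open>
  A point \<open>H x\<close> of \<open>V/H\<close> is rational iff the Frobenius map sends \<open>x\<close> into \<open>H x\<close>. It is periodic iff
  \<open>x\<close> is: if \<open>\<phi>^n x = h x\<close>, then \<open>\<phi>^(n k) x = h^k x\<close> because \<open>\<phi>\<close> commutes with \<open>h\<close>. As in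
  Burnside's lemma, the number of rational periodic points of \<open>V/H\<close> is therefore the average
  over \<open>h \<in> H\<close> of \<open>\<theta> h\<close>, the number of \<open>\<phi>\<close>-periodic \<open>x \<in> V\<close> with \<open>Frob x = h x\<close>; that is,
  \<open>\<theta>\<close> evaluated at \<open>\<epsilon>_H\<close>.

  The class function \<open>\<theta>\<close> need not be a combination of rational characters, but the coefficient of
  \<open>\<alpha> = \<Sum> n_H \<epsilon>_H\<close> at \<open>g\<close> depends only on the cyclic group generated by \<open>g\<close>. For such \<open>\<alpha>\<close>,
  vanishing on the permutation characters of \<open>G/C\<close> with \<open>C\<close> cyclic forces the average of \<open>\<alpha>\<close> over
  each conjugacy class to be zero, so every class function vanishes at \<open>\<alpha>\<close>.
\<close>

section \<open>The Frobenius map\<close>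

text \<open>The polynomial \<open>(X + 1)^q - X^q - 1\<close> has degree below \<open>q\<close> and \<open>q\<close> roots, hence vanishes.\<close>

lemma of_nat_card_choose_eq_0:
  assumes "0 < k" "k < CARD('f::finite_field)"
  shows "(of_nat (CARD('f) choose k) :: 'f) = 0"
proof -
  define q where "q = CARD('f)"
  define p :: "'f poly" where "p = (\<Sum>j\<in>{0<..<q}. Polynomial.monom (of_nat (q choose j)) j)"
  have q: "q \<noteq> 0"
    by (simp add: q_def)
  have "poly p x = 0" for x
  proof -
    have "(x + 1) ^ q = (\<Sum>j\<le>q. of_nat (q choose j) * x ^ j)"
      by (simp add: binomial_ring)
    also have "{..q} = insert 0 (insert q {0<..<q})"
      by auto
    also have "(\<Sum>j\<in>\<dots>. of_nat (q choose j) * x ^ j) = 1 + x ^ q + poly p x"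
      using q by (simp add: p_def poly_sum poly_monom)
    finally show ?thesis
      by (simp add: q_def finite_field_power_card_eq_same)
  qed
  then have roots: "{x. poly p x = 0} = UNIV"
    by auto
  have "p = 0"
  proof (rule ccontr)
    assume "p \<noteq> 0"
    then have "q \<le> Polynomial.degree p"
      using card_poly_roots_bound[of p] by (simp add: roots q_def)
    moreover have "Polynomial.degree p \<le> q - 1"
      unfolding p_def by (rule degree_sum_le) (auto intro: order.trans[OF degree_monom_le])
    ultimately show False
      using q by simp
  qed
  then have "Polynomial.coeff p k = 0"
    by simp
  then show ?thesis
    using assms by (simp add: p_def q_def coeff_sum)
qed

section \<open>The \<open>q\<close>-power map on the algebraic closure,
  \<open>q = CARD('f)\<close>\<close>

lemma power_card_add:
  fixes x y :: "'f::finite_field alg_closure"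
  shows "(x + y) ^ CARD('f) = x ^ CARD('f) + y ^ CARD('f)"
proof -
  let ?q = "CARD('f)"
  have "(x + y) ^ ?q = (\<Sum>j\<le>?q. of_nat (?q choose j) * x ^ j * y ^ (?q - j))"
    by (rule binomial_ring)
  also have "\<dots> = (\<Sum>j\<in>{0, ?q}. of_nat (?q choose j) * x ^ j * y ^ (?q - j))"
  proof (intro sum.mono_neutral_right ballI)
    fix j assume "j \<in> {..?q} - {0, ?q}"
    \<comment> \<open>The coefficient comes from \<open>'f\<close>, where it is already known to
      vanish.\<close>
    then have "to_ac (of_nat (?q choose j) :: 'f) = 0"
      by (subst of_nat_card_choose_eq_0) auto
    then show "of_nat (?q choose j) * x ^ j * y ^ (?q - j) = 0"
      by simp
  qed auto
  finally show ?thesis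
    by (simp add: add_ac)
qed

lemma power_card_sum:
  fixes f :: "'a \<Rightarrow> 'f::finite_field alg_closure"
  shows "(\<Sum>i\<in>A. f i) ^ CARD('f) = (\<Sum>i\<in>A. f i ^ CARD('f))"
  by (induction A rule: infinite_finite_induct) (simp_all add: power_card_add)

text \<open>The \<open>q\<close> elements of \<open>'f\<close> are roots of \<open>X^q - X\<close>,
  and a nonzero polynomial of degree at most \<open>q\<close> has no room for further roots.\<close>

lemma power_card_eq_self_iff:
  fixes x :: "'f::finite_field alg_closure"
  shows "x ^ CARD('f) = x \<longleftrightarrow> x \<in> range to_ac"
proof -
  define q where "q = CARD('f)"
  have fixed: "range to_ac \<subseteq> {x :: 'f alg_closure. x ^ q = x}"
    by (auto simp: q_def finite_field_power_card_eq_same simp flip: to_ac_power)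
  \<comment> \<open>This keeps the two monomials of \<open>p\<close> below from cancelling.\<close>
  have q: "q \<ge> 2"
  proof -
    have "card {0, 1 :: 'f} \<le> q"
      unfolding q_def by (intro card_mono) auto
    then show ?thesis
      by simp
  qed
  define p :: "'f alg_closure poly" where "p = Polynomial.monom 1 q - Polynomial.monom 1 1"
  have "Polynomial.coeff p q = 1"
    using q by (simp add: p_def)
  then have p: "p \<noteq> 0"
    by auto
  have roots: "{x. poly p x = 0} = {x. x ^ q = x}"
    by (simp add: p_def poly_monom)
  have "Polynomial.degree p \<le> q"
    using q unfolding p_def by (intro degree_diff_le order.trans[OF degree_monom_le]) auto
  then have "card {x :: 'f alg_closure. x ^ q = x} \<le> q"
    using card_poly_roots_bound[OF p] by (simp add: roots)
  moreover have "card (range (to_ac :: 'f \<Rightarrow> _)) = q"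
    by (simp add: card_image inj_to_ac q_def)
  moreover have "finite {x :: 'f alg_closure. x ^ q = x}"
    using poly_roots_finite[OF p] by (simp add: roots)
  ultimately have "range to_ac = {x :: 'f alg_closure. x ^ q = x}"
    using fixed by (intro card_seteq) auto
  then show ?thesis
    by (auto simp: q_def)
qed

text \<open>The \<open>q\<close>-power map is additive and multiplicative and fixes the
  coefficients, which lie in \<open>'f\<close>.\<close>

lemma mpol_eval_power_card:
  fixes P :: "'f::finite_field mpol"
  shows "mpol_eval P (\<lambda>i. x i ^ CARD('f)) = mpol_eval P x ^ CARD('f)"
proof -
  have "to_ac a ^ CARD('f) = to_ac a" for a :: 'f
    by (simp add: power_card_eq_self_iff)
  then show ?thesis
    by (simp add: mpol_eval_def power_card_sum power_mult_distrib prod_power_distrib mult.commute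
        flip: power_mult)
qed

text \<open>Mapping all coordinate vectors at once avoids choosing a representative. That the image
  is again a full projective point rests on the existence of \<open>q\<close>-th roots of scalars in
  the closure.\<close>

definition frobenius :: "'f::finite_field proj_point \<Rightarrow> 'f proj_point" where
  "frobenius p = (\<lambda>x i. x i ^ CARD('f)) ` p"

lemma frobenius_proj_pt:
  fixes x :: "nat \<Rightarrow> 'f::finite_field alg_closure"
  shows "frobenius (proj_pt x) = proj_pt (\<lambda>i. x i ^ CARD('f))"
proof
  show "frobenius (proj_pt x) \<subseteq> proj_pt (\<lambda>i. x i ^ CARD('f))"
    by (auto simp: frobenius_def proj_pt_def power_mult_distrib)
  show "proj_pt (\<lambda>i. x i ^ CARD('f)) \<subseteq> frobenius (proj_pt x)"
  proof
    fix y assume "y \<in> proj_pt (\<lambda>i. x i ^ CARD('f))"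
    then obtain c where c: "c \<noteq> 0" "y = (\<lambda>i. c * x i ^ CARD('f))"
      by (auto simp: proj_pt_def)
    obtain b where "b ^ CARD('f) = c"
      using nth_root_exists[of "CARD('f)" c] by auto
    with c have "b \<noteq> 0" "y = (\<lambda>i. (b * x i) ^ CARD('f))"
      by (auto simp: power_mult_distrib)
    then show "y \<in> frobenius (proj_pt x)"
      by (auto simp: frobenius_def proj_pt_def)
  qed
qed

lemma frobenius_in_proj_space:
  assumes "p \<in> proj_space N"
  shows "frobenius p \<in> proj_space N"
proof -
  obtain x where "p = proj_pt x" "\<forall>i>N. x i = 0" "\<exists>i\<le>N. x i \<noteq> 0"
    using assms by (auto simp: proj_space_def)
  then show ?thesis
    unfolding proj_space_def mem_Collect_eq
    by (intro exI[of _ "\<lambda>i. x i ^ CARD('a)"]) (auto simp: frobenius_proj_pt)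
qed

text \<open>A form over \<open>'f\<close> takes at the image the \<open>q\<close>-th power of its
  value, so both vanish together. The equivalence, rather than one implication, is what handles
  differences of closed sets.\<close>

lemma frobenius_in_zariski_closed_iff:
  assumes "zariski_closed N Z" "p \<in> proj_space N"
  shows "frobenius p \<in> Z \<longleftrightarrow> p \<in> Z"
proof -
  obtain S where "Z = {p \<in> proj_space N. \<forall>P\<in>S. \<forall>x\<in>p. mpol_eval P x = 0}"
    using assms(1) by (auto simp: zariski_closed_def)
  moreover have "frobenius p \<in> proj_space N"
    using assms(2) by (rule frobenius_in_proj_space)
  ultimately show ?thesis
    using assms(2) by (auto simp: frobenius_def mpol_eval_power_card)
qed

lemma quasiprojective_subset: "quasiprojective N V \<Longrightarrow> V \<subseteq> proj_space N"
  by (auto simp: quasiprojective_def zariski_closed_def)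

lemma frobenius_in_quasiprojective:
  assumes "quasiprojective N V" "p \<in> V"
  shows "frobenius p \<in> V"
  using assms frobenius_in_zariski_closed_iff quasiprojective_subset[OF assms(1)]
  unfolding quasiprojective_def by blast

text \<open>A neighbourhood of \<open>p\<close> open over \<open>'f\<close> also contains
  \<open>frobenius p\<close>, so the same forms represent \<open>f\<close> at both points, and forms
  over \<open>'f\<close> commute with the \<open>q\<close>-power map.\<close>

lemma is_morphism_frobenius:
  fixes V :: "'f::finite_field proj_point set"
  assumes V: "quasiprojective N V" and f: "is_morphism N V M W f" and p: "p \<in> V"
  shows "f (frobenius p) = frobenius (f p)"
proof -
  obtain U d F where U: "zariski_open_in N V U" "p \<in> U" and F:
    "\<And>r x. r \<in> U \<Longrightarrow> x \<in> r \<Longrightarrow> f r = proj_pt (\<lambda>j. if j \<le> M then mpol_eval (F j) x else 0)"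
  proof -
    have "\<exists>U d F. zariski_open_in N V U \<and> p \<in> U \<and> (\<forall>j\<le>M. is_form N d (F j)) \<and>
        (\<forall>r\<in>U. \<forall>x\<in>r. (\<exists>j\<le>M. mpol_eval (F j) x \<noteq> 0) \<and>
           f r = proj_pt (\<lambda>j. if j \<le> M then mpol_eval (F j) x else 0))"
      using f p unfolding is_morphism_def by blast
    then show thesis
      by (elim exE conjE) (rule that, auto)
  qed
  have pN: "p \<in> proj_space N"
    using quasiprojective_subset[OF V] p by auto
  have "frobenius p \<in> U"
    using U frobenius_in_quasiprojective[OF V p] frobenius_in_zariski_closed_iff[OF _ pN]
    by (auto simp: zariski_open_in_def)
  moreover obtain x where x: "x \<in> p"
    using pN by (auto simp: proj_space_def proj_pt_def)
  moreover from x have "(\<lambda>i. x i ^ CARD('f)) \<in> frobenius p"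
    by (auto simp: frobenius_def)
  ultimately have "f (frobenius p)
      = proj_pt (\<lambda>j. if j \<le> M then mpol_eval (F j) (\<lambda>i. x i ^ CARD('f)) else 0)"
    by (intro F)
  also have "\<dots> = proj_pt (\<lambda>j. (if j \<le> M then mpol_eval (F j) x else 0) ^ CARD('f))"
    by (intro arg_cong[where f = proj_pt] ext) (simp add: mpol_eval_power_card)
  also have "\<dots> = frobenius (f p)"
    using F[OF U(2) x] by (simp add: frobenius_proj_pt)
  finally show ?thesis .
qed

section \<open>Rational points as the fixed points of Frobenius\<close>

lemma proj_pt_scale:
  assumes "c \<noteq> 0"
  shows "proj_pt (\<lambda>j. c * x j) = proj_pt x"
proof
  show "proj_pt (\<lambda>j. c * x j) \<subseteq> proj_pt x"
  proof
    fix z assume "z \<in> proj_pt (\<lambda>j. c * x j)"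
    then obtain b where "b \<noteq> 0" "z = (\<lambda>j. b * (c * x j))"
      by (auto simp: proj_pt_def)
    then show "z \<in> proj_pt x"
      using assms unfolding proj_pt_def mem_Collect_eq
      by (intro exI[of _ "b * c"]) (simp add: mult.assoc)
  qed
  show "proj_pt x \<subseteq> proj_pt (\<lambda>j. c * x j)"
  proof
    fix z assume "z \<in> proj_pt x"
    then obtain b where "b \<noteq> 0" "z = (\<lambda>j. b * x j)"
      by (auto simp: proj_pt_def)
    then show "z \<in> proj_pt (\<lambda>j. c * x j)"
      using assms unfolding proj_pt_def mem_Collect_eq
      by (intro exI[of _ "b / c"]) simp
  qed
qed

lemma proj_space_normalized:
  assumes "p \<in> proj_space N"
  obtains x i where "p = proj_pt x" "\<And>j. j > N \<Longrightarrow> x j = 0" "x i = 1"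
proof -
  obtain y i where y: "p = proj_pt y" "\<forall>j>N. y j = 0" "y i \<noteq> 0"
    using assms by (auto simp: proj_space_def)
  have "proj_pt (\<lambda>j. y j / y i) = proj_pt y"
    using proj_pt_scale[of "inverse (y i)" y] y by (simp add: field_simps)
  with y show thesis
    by (intro that[of "\<lambda>j. y j / y i" i]) auto
qed

lemma proj_pt_refl: "x \<in> proj_pt x"
  unfolding proj_pt_def by (auto intro: exI[of _ 1])

text \<open>Being fixed only gives \<open>x j ^ q = c * x j\<close> with an unknown scalar
  \<open>c\<close>; the coordinate equal to 1 forces \<open>c = 1\<close>.\<close>

lemma frobenius_fixed_normalized:
  fixes x :: "nat \<Rightarrow> 'f::finite_field alg_closure"
  assumes "frobenius (proj_pt x) = proj_pt x" "x i = 1"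
  shows "range x \<subseteq> range to_ac"
proof -
  have "(\<lambda>j. x j ^ CARD('f)) \<in> proj_pt x"
    using assms(1) proj_pt_refl[of "\<lambda>j. x j ^ CARD('f)"] by (simp add: frobenius_proj_pt)
  then obtain c where c: "\<And>j. x j ^ CARD('f) = c * x j"
    by (auto simp: proj_pt_def fun_eq_iff)
  from c[of i] have "c = 1"
    by (simp add: assms(2))
  with c show ?thesis
    by (auto simp: power_card_eq_self_iff[symmetric])
qed

lemma frobenius_fixed_iff:
  fixes p :: "'f::finite_field proj_point"
  assumes "p \<in> proj_space N"
  shows "frobenius p = p \<longleftrightarrow> (\<exists>x\<in>p. range x \<subseteq> range to_ac)"
proof
  assume fixed: "frobenius p = p"
  obtain x i where x: "p = proj_pt x" "x i = 1"
    using proj_space_normalized[OF assms] by blast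
  have "range x \<subseteq> range to_ac"
    using fixed x by (intro frobenius_fixed_normalized) auto
  then show "\<exists>x\<in>p. range x \<subseteq> range to_ac"
    using proj_pt_refl x(1) by blast
next
  assume "\<exists>x\<in>p. range x \<subseteq> range to_ac"
  then obtain x where x: "x \<in> p" "range x \<subseteq> range to_ac"
    by blast
  from x(2) have fixed: "x j ^ CARD('f) = x j" for j
    by (simp add: power_card_eq_self_iff image_subset_iff)
  obtain y where y: "p = proj_pt y"
    using assms by (auto simp: proj_space_def)
  with x obtain c where "c \<noteq> 0" "x = (\<lambda>j. c * y j)"
    by (auto simp: proj_pt_def)
  then have "proj_pt x = proj_pt y"
    by (simp add: proj_pt_scale)
  then show "frobenius p = p"
    using x y fixed by (metis (no_types, lifting) ext frobenius_proj_pt)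
qed

lemma rational_points_eq_frobenius_fixed:
  assumes "quasiprojective N V"
  shows "rational_points V = {p \<in> V. frobenius p = p}"
  using quasiprojective_subset[OF assms] frobenius_fixed_iff
  unfolding rational_points_def by blast

text \<open>Normalized coordinate vectors of rational points have entries in the finite field and
  vanish beyond index \<open>N\<close>, so there are finitely many.\<close>

lemma finite_rational_points:
  fixes V :: "'f::finite_field proj_point set"
  assumes "quasiprojective N V"
  shows "finite (rational_points V)"
proof (rule finite_subset)
  let ?X = "{x :: nat \<Rightarrow> 'f alg_closure. range x \<subseteq> range to_ac \<and> (\<forall>i>N. x i = 0)}"
  show "rational_points V \<subseteq> proj_pt ` ?X"
  proof
    fix p assume "p \<in> rational_points V"
    then have p: "p \<in> proj_space N" and "frobenius p = p"
      using quasiprojective_subset[OF assms] rational_points_eq_frobenius_fixed[OF assms] by auto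
    obtain x i where x: "p = proj_pt x" "\<And>j. j > N \<Longrightarrow> x j = 0" "x i = 1"
      using proj_space_normalized[OF p] by blast
    moreover have "range x \<subseteq> range to_ac"
      using \<open>frobenius p = p\<close> x by (intro frobenius_fixed_normalized) auto
    ultimately show "p \<in> proj_pt ` ?X"
      by auto
  qed
  have "finite {x :: nat \<Rightarrow> 'f alg_closure. \<forall>i. (i \<in> {..N} \<longrightarrow> x i \<in> range to_ac) \<and>
      (i \<notin> {..N} \<longrightarrow> x i = 0)}"
    by (rule finite_set_of_finite_funs) auto
  then show "finite (proj_pt ` ?X)"
    by (intro finite_imageI) (auto elim!: rev_finite_subset)
qed

section \<open>Permutation characters\<close>

text \<open>After enumerating \<open>E\<close>, the action is given by permutation matrices, whose
  traces count fixed points.\<close>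

lemma (in group_action) rational_character_card_invariants:
  assumes "finite E"
  shows "rational_character G (\<lambda>g. of_nat (card (invariants E \<phi> g)))"
proof -
  interpret group G
    using group_hom group_hom.axioms(1) by auto
  define d where "d = card E"
  obtain e where e: "bij_betw e {..<d} E"
    using ex_bij_betw_nat_finite[OF assms] by (auto simp: d_def atLeast0LessThan)
  have e_in: "e i \<in> E" if "i < d" for i
    using bij_betwE[OF e] that by auto
  have e_eq: "e i = e j \<longleftrightarrow> i = j" if "i < d" "j < d" for i j
    using bij_betw_imp_inj_on[OF e] that by (auto simp: inj_on_eq_iff)
  have e_surj: "\<exists>i<d. e i = x" if "x \<in> E" for x
    using bij_betw_imp_surj_on[OF e] that by (auto simp: image_iff)
  define \<rho> :: "'a \<Rightarrow> rat mat"
    where "\<rho> g = mat d d (\<lambda>(i, j). if \<phi> g (e j) = e i then 1 else 0)" for g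
  have one: "\<rho> \<one> = 1\<^sub>m d"
  proof (rule eq_matI)
    fix i j assume "i < dim_row (1\<^sub>m d :: rat mat)" "j < dim_col (1\<^sub>m d :: rat mat)"
    then have ij: "i < d" "j < d"
      by auto
    have "\<phi> \<one> (e j) = e j"
      using e_in[OF ij(2)] by (simp flip: id_eq_one)
    then show "\<rho> \<one> $$ (i, j) = 1\<^sub>m d $$ (i, j)"
      using ij by (auto simp: \<rho>_def e_eq)
  qed (auto simp: \<rho>_def)
  have mult: "\<rho> (g \<otimes> h) = \<rho> g * \<rho> h" if g: "g \<in> carrier G" and h: "h \<in> carrier G" for g h
  proof (rule eq_matI)
    fix i j assume "i < dim_row (\<rho> g * \<rho> h)" "j < dim_col (\<rho> g * \<rho> h)"
    then have ij: "i < d" "j < d"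
      by (auto simp: \<rho>_def)
    \<comment> \<open>\<open>l\<close> is the only index that can contribute to entry
      \<open>(i, j)\<close> of the matrix product.\<close>
    obtain l where l: "l < d" "e l = \<phi> h (e j)"
      using e_surj[OF element_image[OF h e_in[OF ij(2)] refl]] by blast
    have "(\<rho> g * \<rho> h) $$ (i, j) = (\<Sum>k<d. \<rho> g $$ (i, k) * \<rho> h $$ (k, j))"
      using ij by (simp add: \<rho>_def scalar_prod_def atLeast0LessThan)
    also have "\<dots> = (\<Sum>k<d. if k = l then \<rho> g $$ (i, l) else 0)"
      using ij l(1) by (intro sum.cong) (auto simp: \<rho>_def e_eq simp flip: l(2))
    also have "\<dots> = \<rho> g $$ (i, l)"
      using l by simp
    also have "\<dots> = \<rho> (g \<otimes> h) $$ (i, j)"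
      using ij l g h e_in by (simp add: \<rho>_def composition_rule)
    finally show "\<rho> (g \<otimes> h) $$ (i, j) = (\<rho> g * \<rho> h) $$ (i, j)" ..
  qed (auto simp: \<rho>_def)
  have trace: "of_nat (card (invariants E \<phi> g)) = (\<Sum>i<d. \<rho> g $$ (i, i))" for g
  proof -
    have "card (invariants E \<phi> g) = (\<Sum>x\<in>E. if \<phi> g x = x then 1 else 0)"
      unfolding invariants_def using assms by (rule card_as_sums[OF refl])
    also have "\<dots> = (\<Sum>i<d. if \<phi> g (e i) = e i then 1 else 0)"
      by (rule sum.reindex_bij_betw[OF e, symmetric])
    finally show ?thesis
      by (simp add: \<rho>_def of_nat_sum if_distrib cong: if_cong)
  qed
  show ?thesis
    unfolding rational_character_def
    by (intro exI[of _ d] exI[of _ \<rho>] conjI ballI)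
       (auto simp: one mult trace, auto simp: \<rho>_def)
qed

text \<open>In \<open>group_action\<close> the group acts through \<open>BijGroup E\<close>, whose
  elements are extensional; hence the restriction to \<open>E\<close>.\<close>

lemma group_actionI:
  assumes "group G"
    and maps: "\<And>g x. g \<in> carrier G \<Longrightarrow> x \<in> E \<Longrightarrow> act g x \<in> E"
    and one: "\<And>x. x \<in> E \<Longrightarrow> act \<one>\<^bsub>G\<^esub> x = x"
    and mult: "\<And>g h x. g \<in> carrier G \<Longrightarrow> h \<in> carrier G \<Longrightarrow> x \<in> E \<Longrightarrow>
      act (g \<otimes>\<^bsub>G\<^esub> h) x = act g (act h x)"
  shows "group_action G E (\<lambda>g. \<lambda>x\<in>E. act g x)"
proof -
  interpret group G by fact
  have inverse: "act g (act (inv\<^bsub>G\<^esub> g) x) = x" "act (inv\<^bsub>G\<^esub> g) (act g x) = x"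
    if "g \<in> carrier G" "x \<in> E" for g x
    using that one by (simp_all flip: mult)
  have Bij: "(\<lambda>x\<in>E. act g x) \<in> Bij E" if "g \<in> carrier G" for g
    unfolding Bij_def
    using that maps inverse
    by (auto intro!: bij_betw_byWitness[where f' = "act (inv\<^bsub>G\<^esub> g)"])
  show ?thesis
    unfolding group_action_def group_hom_def group_hom_axioms_def hom_def
    using group_BijGroup Bij maps
    by (auto simp: BijGroup_def compose_def mult is_group intro!: ext)
qed

section \<open>The permutation character on the left cosets of a subgroup\<close>

lemma (in group) lcosets_action:
  assumes "subgroup C G"
  shows "group_action G (lcosets C) (\<lambda>g. \<lambda>Q\<in>lcosets C. g <# Q)"
proof (rule group_actionI[OF is_group])
  have sub: "C \<subseteq> carrier G"
    using assms by (rule subgroup.subset)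
  have coset_subset: "Q \<subseteq> carrier G" if "Q \<in> lcosets C" for Q
    using subgroup.lcosets_carrier[OF assms is_group that] .
  show "g <# Q \<in> lcosets C" if "g \<in> carrier G" "Q \<in> lcosets C" for g Q
    using that sub by (auto simp: LCOSETS_def lcos_m_assoc)
  show "\<one> <# Q = Q" if "Q \<in> lcosets C" for Q
    using coset_subset[OF that] by (rule lcos_mult_one)
  show "g \<otimes> h <# Q = g <# (h <# Q)"
    if "g \<in> carrier G" "h \<in> carrier G" "Q \<in> lcosets C" for g h Q
    using coset_subset[OF that(3)] that by (simp add: lcos_m_assoc)
qed

lemma (in group) l_coset_fixed_iff:
  assumes C: "subgroup C G" and g: "g \<in> carrier G" and x: "x \<in> carrier G"
  shows "g <# (x <# C) = x <# C \<longleftrightarrow> inv x \<otimes> g \<otimes> x \<in> C"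
proof -
  have "g <# (x <# C) = (g \<otimes> x) <# C"
    using subgroup.subset[OF C] g x by (simp add: lcos_m_assoc)
  also have "\<dots> = x <# C \<longleftrightarrow> g \<otimes> x \<in> x <# C"
    using l_repr_independence[OF _ x C, of "g \<otimes> x"] lcos_self[of "g \<otimes> x" C] C g x by auto
  also have "\<dots> \<longleftrightarrow> inv x \<otimes> (g \<otimes> x) \<in> C"
    using subgroup.lcos_module_imp[OF C is_group x] subgroup.lcos_module_rev[OF C is_group x] g x
    by blast
  finally show ?thesis
    using g x by (simp add: m_assoc)
qed

text \<open>The set on the left is the disjoint union of the cosets fixed by \<open>g\<close>. This
  is the formula for the character induced from the trivial character of \<open>C\<close>, cleared
  of denominators.\<close>

lemma (in group) card_lcosets_invariants:
  assumes fin: "finite (carrier G)" and C: "subgroup C G" and g: "g \<in> carrier G"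
  shows "card {x \<in> carrier G. inv x \<otimes> g \<otimes> x \<in> C}
    = card C * card (invariants (lcosets C) (\<lambda>g. \<lambda>Q\<in>lcosets C. g <# Q) g)"
    (is "card ?A = _ * card ?I")
proof -
  have fin_lcosets: "finite (lcosets C)"
    using fin by (auto simp: LCOSETS_def)
  have union: "?A = \<Union>?I"
  proof (intro equalityI subsetI)
    fix x assume "x \<in> ?A"
    then show "x \<in> \<Union>?I"
      using l_coset_fixed_iff[OF C g, of x] lcos_self[OF _ C]
      by (auto simp: invariants_def LCOSETS_def)
  next
    fix x assume "x \<in> \<Union>?I"
    then obtain Q where "Q \<in> lcosets C" "g <# Q = Q" "x \<in> Q"
      by (auto simp: invariants_def)
    then obtain y where y: "y \<in> carrier G" "x \<in> y <# C" "g <# (y <# C) = y <# C"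
      by (auto simp: LCOSETS_def)
    have x: "x \<in> carrier G" "y <# C = x <# C"
      using y C l_repr_independence l_coset_carrier by blast+
    then show "x \<in> ?A"
      using y l_coset_fixed_iff[OF C g, of x] by auto
  qed
  have "card C * card ?I = card (\<Union>?I)"
  proof (rule card_partition)
    show "finite ?I"
      using fin_lcosets by (simp add: invariants_def)
    show "finite (\<Union>?I)"
      using fin by (simp flip: union)
    show "card Q = card C" if "Q \<in> ?I" for Q
      using that l_card_cosets_equal[OF _ subgroup.subset[OF C] fin]
      by (auto simp: invariants_def)
    show "Q \<inter> Y = {}" if "Q \<in> ?I" "Y \<in> ?I" "Q \<noteq> Y" for Q Y
      using that lcos_disjoint[OF C] by (auto simp: invariants_def)
  qed
  then show ?thesis
    by (simp add: union)
qed

section \<open>Elements of the group algebra killed by the rational characters\<close>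

lemma (in group) inv_mult_cancel:
  assumes "x \<in> carrier G" "y \<in> carrier G"
  shows "inv x \<otimes> (x \<otimes> y) = y" "x \<otimes> (inv x \<otimes> y) = y"
  using assms by (simp_all flip: m_assoc)

lemma (in group) conjugation_bij_betw:
  assumes "x \<in> carrier G"
  shows "bij_betw (\<lambda>g. x \<otimes> g \<otimes> inv x) (carrier G) (carrier G)"
  using assms
  by (intro bij_betw_byWitness[where f' = "\<lambda>g. inv x \<otimes> g \<otimes> x"])
     (auto simp: m_assoc inv_mult_cancel)

lemma (in group) generate_conjugate:
  assumes "x \<in> carrier G" "g \<in> carrier G"
  shows "generate G {x \<otimes> g \<otimes> inv x} = (\<lambda>h. x \<otimes> h \<otimes> inv x) ` generate G {g}"
proof -
  interpret group_hom G G "\<lambda>h. x \<otimes> h \<otimes> inv x"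
  proof unfold_locales
    show "(\<lambda>h. x \<otimes> h \<otimes> inv x) \<in> hom G G"
      using assms(1) by (auto simp: hom_def m_assoc inv_mult_cancel)
  qed
  show ?thesis
    using generate_img[of "{g}"] assms(2) by simp
qed

text \<open>The double sum is \<open>card C\<close> times the value at \<open>\<alpha>\<close> of
  the permutation character on the cosets of \<open>C\<close>.\<close>

lemma (in group) char_equiv_zero_sum_conjugates_subgroup:
  assumes fin: "finite (carrier G)" and \<alpha>: "char_equiv_zero G \<alpha>" and C: "subgroup C G"
  shows "(\<Sum>g\<in>C. \<Sum>x\<in>carrier G. \<alpha> (x \<otimes> g \<otimes> inv x)) = 0"
proof -
  let ?act = "\<lambda>g. \<lambda>Q\<in>lcosets C. g <# Q"
  interpret act: group_action G "lcosets C" ?act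
    using C by (rule lcosets_action)
  have "finite (lcosets C)"
    using fin by (auto simp: LCOSETS_def)
  then have "rational_character G (\<lambda>g. of_nat (card (invariants (lcosets C) ?act g)))"
    by (rule act.rational_character_card_invariants)
  with \<alpha> have zero:
    "(\<Sum>g\<in>carrier G. \<alpha> g * of_nat (card (invariants (lcosets C) ?act g))) = 0"
    by (auto simp: char_equiv_zero_def)
  \<comment> \<open>Conjugation moves \<open>x\<close> from the argument of \<open>\<alpha>\<close>
    into the condition; after swapping the sums, the weight of \<open>\<alpha> g\<close> is a count
    of such \<open>x\<close>.\<close>
  have "(\<Sum>g\<in>C. \<alpha> (x \<otimes> g \<otimes> inv x))
      = (\<Sum>g\<in>carrier G. if inv x \<otimes> g \<otimes> x \<in> C then \<alpha> g else 0)" if x: "x \<in> carrier G" for x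
  proof -
    have "(\<Sum>g\<in>C. \<alpha> (x \<otimes> g \<otimes> inv x))
        = (\<Sum>g\<in>carrier G. if g \<in> C then \<alpha> (x \<otimes> g \<otimes> inv x) else 0)"
      using fin subgroup.subset[OF C] by (simp add: sum.inter_restrict[symmetric] Int_absorb1)
    also have "\<dots> = (\<Sum>g\<in>carrier G.
        if inv x \<otimes> (x \<otimes> g \<otimes> inv x) \<otimes> x \<in> C then \<alpha> (x \<otimes> g \<otimes> inv x) else 0)"
      using x by (intro sum.cong refl) (simp add: m_assoc inv_mult_cancel)
    also have "\<dots> = (\<Sum>g\<in>carrier G. if inv x \<otimes> g \<otimes> x \<in> C then \<alpha> g else 0)"
      by (rule sum.reindex_bij_betw[OF conjugation_bij_betw[OF x]])
    finally show ?thesis .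
  qed
  then have "(\<Sum>g\<in>C. \<Sum>x\<in>carrier G. \<alpha> (x \<otimes> g \<otimes> inv x))
      = (\<Sum>x\<in>carrier G. \<Sum>g\<in>carrier G. if inv x \<otimes> g \<otimes> x \<in> C then \<alpha> g else 0)"
    by (subst sum.swap) simp
  also have "\<dots> = (\<Sum>g\<in>carrier G. \<alpha> g * of_nat (card {x \<in> carrier G. inv x \<otimes> g \<otimes> x \<in> C}))"
    using fin by (subst sum.swap) (simp add: sum.inter_filter[symmetric] mult.commute)
  also have "\<dots> = of_nat (card C) *
      (\<Sum>g\<in>carrier G. \<alpha> g * of_nat (card (invariants (lcosets C) ?act g)))"
    unfolding sum_distrib_left
    by (intro sum.cong refl, subst card_lcosets_invariants[OF fin C]) auto
  finally show ?thesis
    by (simp add: zero)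
qed

text \<open>Moebius inversion over cyclic subgroups: the sum over each cyclic subgroup vanishes, hence so
  does the contribution of its generators, on which the summand is constant.\<close>

lemma (in group) char_equiv_zero_sum_conjugates:
  assumes fin: "finite (carrier G)" and \<alpha>: "char_equiv_zero G \<alpha>"
    and cyclic: "\<And>g h. g \<in> carrier G \<Longrightarrow> h \<in> carrier G \<Longrightarrow>
      generate G {g} = generate G {h} \<Longrightarrow> \<alpha> g = \<alpha> h"
    and g: "g \<in> carrier G"
  shows "(\<Sum>x\<in>carrier G. \<alpha> (x \<otimes> g \<otimes> inv x)) = 0"
  using g
proof (induction "card (generate G {g})" arbitrary: g rule: less_induct)
  case less
  define A where "A h = (\<Sum>x\<in>carrier G. \<alpha> (x \<otimes> h \<otimes> inv x))" for h
  define C where "C = generate G {g}"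
  have C: "subgroup C G" and g_C: "g \<in> C"
    using less.prems by (auto simp: C_def generate_is_subgroup generate.incl)
  have C_sub: "C \<subseteq> carrier G"
    using C by (rule subgroup.subset)
  have fin_C: "finite C"
    using C_sub fin by (rule finite_subset)
  \<comment> \<open>The generators of \<open>C\<close>; every other element generates a smaller
    cyclic group, where the induction hypothesis applies.\<close>
  define D where "D = {h \<in> C. generate G {h} = C}"
  have "A h = 0" if "h \<in> C - D" for h
  proof -
    have "generate G {h} \<subseteq> C"
      using C that by (intro generate_subgroup_incl) auto
    with that have "generate G {h} \<subset> C"
      by (auto simp: D_def)
    then have "card (generate G {h}) < card (generate G {g})"
      using psubset_card_mono[OF fin_C] by (simp add: C_def)
    then show ?thesis
      unfolding A_def using that C_sub by (intro less.hyps) auto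
  qed
  then have "(\<Sum>h\<in>D. A h) = (\<Sum>h\<in>C. A h)"
    using fin_C by (intro sum.mono_neutral_left) (auto simp: D_def)
  also have "\<dots> = 0"
    unfolding A_def by (rule char_equiv_zero_sum_conjugates_subgroup[OF fin \<alpha> C])
  finally have "(\<Sum>h\<in>D. A h) = 0" .
  \<comment> \<open>Conjugating two generators of one cyclic group gives generators of one conjugate
    group, and \<open>\<alpha>\<close> sees only that group.\<close>
  moreover have "A h = A g" if "h \<in> D" for h
    unfolding A_def
  proof (intro sum.cong refl cyclic)
    fix x assume "x \<in> carrier G"
    then show "generate G {x \<otimes> h \<otimes> inv x} = generate G {x \<otimes> g \<otimes> inv x}"
      using that less.prems C_sub by (subst (1 2) generate_conjugate) (auto simp: D_def C_def)
  qed (use that less.prems C_sub in \<open>auto simp: D_def\<close>)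
  ultimately have "of_nat (card D) * A g = 0"
    by simp
  moreover have "g \<in> D" "finite D"
    using g_C fin_C by (auto simp: D_def C_def)
  ultimately show ?case
    by (auto simp: A_def)
qed

text \<open>Averaging over all conjugations leaves \<open>\<theta>\<close> unchanged and replaces
  \<open>\<alpha> g\<close> by its sum over conjugates, which vanishes.\<close>

lemma (in group) char_equiv_zero_sum_class_function:
  assumes fin: "finite (carrier G)" and \<alpha>: "char_equiv_zero G \<alpha>"
    and cyclic: "\<And>g h. g \<in> carrier G \<Longrightarrow> h \<in> carrier G \<Longrightarrow>
      generate G {g} = generate G {h} \<Longrightarrow> \<alpha> g = \<alpha> h"
    and conj: "\<And>g x. g \<in> carrier G \<Longrightarrow> x \<in> carrier G \<Longrightarrow> \<theta> (x \<otimes> g \<otimes> inv x) = \<theta> g"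
  shows "(\<Sum>g\<in>carrier G. \<alpha> g * \<theta> g) = 0"
proof -
  have "of_nat (Coset.order G) * (\<Sum>g\<in>carrier G. \<alpha> g * \<theta> g)
      = (\<Sum>x\<in>carrier G. \<Sum>g\<in>carrier G. \<alpha> g * \<theta> g)"
    by (simp add: Coset.order_def)
  also have "\<dots> = (\<Sum>x\<in>carrier G. \<Sum>g\<in>carrier G. \<alpha> (x \<otimes> g \<otimes> inv x) * \<theta> g)"
  proof (rule sum.cong[OF refl])
    fix x assume x: "x \<in> carrier G"
    have "(\<Sum>g\<in>carrier G. \<alpha> g * \<theta> g)
        = (\<Sum>g\<in>carrier G. \<alpha> (x \<otimes> g \<otimes> inv x) * \<theta> (x \<otimes> g \<otimes> inv x))"
      by (rule sum.reindex_bij_betw[OF conjugation_bij_betw[OF x], symmetric])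
    then show "(\<Sum>g\<in>carrier G. \<alpha> g * \<theta> g) = (\<Sum>g\<in>carrier G. \<alpha> (x \<otimes> g \<otimes> inv x) * \<theta> g)"
      using x by (simp add: conj)
  qed
  also have "\<dots> = (\<Sum>g\<in>carrier G. (\<Sum>x\<in>carrier G. \<alpha> (x \<otimes> g \<otimes> inv x)) * \<theta> g)"
    by (subst sum.swap) (simp add: sum_distrib_right)
  also have "\<dots> = 0"
  proof (intro sum.neutral ballI)
    fix g assume "g \<in> carrier G"
    with fin \<alpha> cyclic have "(\<Sum>x\<in>carrier G. \<alpha> (x \<otimes> g \<otimes> inv x)) = 0"
      by (rule char_equiv_zero_sum_conjugates)
    then show "(\<Sum>x\<in>carrier G. \<alpha> (x \<otimes> g \<otimes> inv x)) * \<theta> g = 0"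
      by simp
  qed
  finally have "of_nat (Coset.order G) * (\<Sum>g\<in>carrier G. \<alpha> g * \<theta> g) = 0" .
  moreover have "Coset.order G \<noteq> 0"
    using order_gt_0_iff_finite fin by simp
  ultimately show ?thesis
    by simp
qed

section \<open>Counting orbits\<close>

text \<open>Burnside's lemma twisted by an equivariant \<open>F\<close>. For \<open>x\<close> in
  \<open>T\<close> the \<open>g\<close> with \<open>F x = \<phi> g x\<close> form a coset of the
  stabilizer, so each orbit in \<open>T\<close> contributes the group order. Finiteness is asked of
  \<open>T\<close>, since \<open>S\<close> may be infinite.\<close>

lemma (in group_action) sum_card_twisted_fixed_points:
  assumes fin: "finite (carrier G)" "finite T"
    and S: "S \<subseteq> E" "\<And>g x. g \<in> carrier G \<Longrightarrow> x \<in> S \<Longrightarrow> \<phi> g x \<in> S"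
    and F: "\<And>x. x \<in> S \<Longrightarrow> F x \<in> E"
      "\<And>g x. g \<in> carrier G \<Longrightarrow> x \<in> S \<Longrightarrow> F (\<phi> g x) = \<phi> g (F x)"
    and \<pi>: "\<And>x y. x \<in> S \<Longrightarrow> y \<in> S \<Longrightarrow> \<pi> x = \<pi> y \<longleftrightarrow> y \<in> orbit G \<phi> x"
    and T: "T = {x \<in> S. F x \<in> orbit G \<phi> x}"
  shows "(\<Sum>g\<in>carrier G. card {x \<in> S. F x = \<phi> g x}) = Coset.order G * card (\<pi> ` T)"
proof -
  interpret group G
    using group_hom group_hom.axioms(1) by auto
  have stabilizer_card: "card {g \<in> carrier G. F x = \<phi> g x} = card (stabilizer G \<phi> x)"
    if x_T: "x \<in> T" for x
  proof -
    have x: "x \<in> E"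
      using x_T S(1) T by auto
    obtain k where k: "k \<in> carrier G" "F x = \<phi> k x"
      using x_T unfolding T orbit_def by blast
    have shift: "\<phi> (inv k \<otimes> g) x = x \<longleftrightarrow> F x = \<phi> g x" if g: "g \<in> carrier G" for g
    proof -
      have "\<phi> (inv k) (\<phi> k x) = x"
        using orbit_sym_aux[OF k(1) x refl] .
      moreover have "\<phi> (inv k \<otimes> g) x = \<phi> (inv k) (\<phi> g x)"
        using x k(1) g by (intro composition_rule) auto
      ultimately have "\<phi> (inv k \<otimes> g) x = x \<longleftrightarrow> \<phi> (inv k) (\<phi> g x) = \<phi> (inv k) (\<phi> k x)"
        by simp
      also have "\<dots> \<longleftrightarrow> \<phi> g x = \<phi> k x"
        using inj_on_eq_iff[OF inj_prop[of "inv k"]] k(1) g element_image[OF _ x refl] by simp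
      finally show ?thesis
        using k(2) by auto
    qed
    have "bij_betw (\<lambda>g. inv k \<otimes> g) {g \<in> carrier G. F x = \<phi> g x} (stabilizer G \<phi> x)"
    proof (rule bij_betw_byWitness[where f' = "\<lambda>g. k \<otimes> g"])
      show "(\<lambda>g. k \<otimes> g) ` stabilizer G \<phi> x \<subseteq> {g \<in> carrier G. F x = \<phi> g x}"
        using k x by (auto simp: stabilizer_def composition_rule)
    qed (use k shift in \<open>auto simp: stabilizer_def m_assoc[symmetric]\<close>)
    then show ?thesis
      by (rule bij_betw_same_card)
  qed
  have T_stable: "\<phi> g x \<in> T" if g: "g \<in> carrier G" and x: "x \<in> T" for g x
  proof -
    have xE: "x \<in> E" "x \<in> S"
      using x S(1) T by auto
    obtain k where k: "k \<in> carrier G" "F x = \<phi> k x"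
      using x unfolding T orbit_def by blast
    \<comment> \<open>Moving \<open>x\<close> by \<open>g\<close> conjugates the element that
      realizes \<open>F\<close>.\<close>
    have "F (\<phi> g x) = \<phi> (g \<otimes> k \<otimes> inv g) (\<phi> g x)"
      using g k xE F(2) orbit_sym_aux[OF g xE(1) refl] element_image[OF g xE(1) refl]
      by (simp add: composition_rule)
    moreover have "g \<otimes> k \<otimes> inv g \<in> carrier G"
      using g k by auto
    ultimately show ?thesis
      using S(2)[OF g xE(2)] unfolding T orbit_def by blast
  qed
  have fibre: "{y \<in> T. \<pi> y = \<pi> x} = orbit G \<phi> x" if x: "x \<in> T" for x
  proof -
    have "y \<in> T" if "y \<in> orbit G \<phi> x" for y
      using that T_stable[OF _ x] by (auto simp: orbit_def)
    moreover have "\<pi> y = \<pi> x \<longleftrightarrow> y \<in> orbit G \<phi> x" if "y \<in> T" for y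
      using \<pi>[of x y] x that by (auto simp: T)
    ultimately show ?thesis
      by blast
  qed
  have "{x \<in> S. F x = \<phi> g x} = {x \<in> T. F x = \<phi> g x}" if "g \<in> carrier G" for g
    using that by (auto simp: T orbit_def)
  then have "(\<Sum>g\<in>carrier G. card {x \<in> S. F x = \<phi> g x})
      = (\<Sum>g\<in>carrier G. \<Sum>x\<in>T. if F x = \<phi> g x then 1 else 0)"
    using fin(2) by (intro sum.cong refl) (simp add: card_as_sums[OF refl])
  also have "\<dots> = (\<Sum>x\<in>T. \<Sum>g\<in>carrier G. if F x = \<phi> g x then 1 else 0)"
    by (rule sum.swap)
  also have "\<dots> = (\<Sum>x\<in>T. card (stabilizer G \<phi> x))"
    using fin(1) by (intro sum.cong refl) (simp add: card_as_sums[OF refl] flip: stabilizer_card)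
  also have "\<dots> = (\<Sum>y\<in>\<pi> ` T. \<Sum>x\<in>{x \<in> T. \<pi> x = y}. card (stabilizer G \<phi> x))"
    using fin(2) by (rule sum.image_gen)
  also have "\<dots> = (\<Sum>y\<in>\<pi> ` T. Coset.order G)"
  proof (rule sum.cong[OF refl])
    fix y assume "y \<in> \<pi> ` T"
    then obtain x where x: "x \<in> T" "y = \<pi> x"
      by blast
    then have "orbit G \<phi> x \<in> orbits G E \<phi>"
      using S(1) T by (auto simp: orbits_def)
    then show "(\<Sum>x\<in>{x \<in> T. \<pi> x = y}. card (stabilizer G \<phi> x)) = Coset.order G"
      using card_stablizer_sum[OF fin(1)] fibre[OF x(1)] x(2) by simp
  qed
  finally show ?thesis
    by (simp add: mult.commute)
qed

text \<open>By equivariance, each application of \<open>f\<close> contributes one more factor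
  \<open>g\<close>. With \<open>k\<close> the order of a finite group, this makes \<open>x\<close>
  periodic.\<close>

lemma (in group_action) commuting_funpow_eq:
  assumes f: "\<And>x. x \<in> E \<Longrightarrow> f x \<in> E"
      "\<And>g x. g \<in> carrier G \<Longrightarrow> x \<in> E \<Longrightarrow> f (\<phi> g x) = \<phi> g (f x)"
    and x: "x \<in> E" and g: "g \<in> carrier G" "f x = \<phi> g x"
  shows "(f ^^ k) x = \<phi> (g [^]\<^bsub>G\<^esub> k) x"
proof -
  interpret group G
    using group_hom group_hom.axioms(1) by auto
  show ?thesis
  proof (induction k)
    case 0
    show ?case
      using x by (simp flip: id_eq_one)
  next
    case (Suc k)
    then show ?case
      using assms by (simp add: composition_rule)
  qed
qed

text \<open>Right multiplication by \<open>x\<close> is injective on the finite set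
  \<open>H\<close>, hence surjective, so it attains \<open>\<one>\<close>.\<close>

lemma (in group) finite_closed_imp_subgroup:
  assumes fin: "finite H" and sub: "H \<subseteq> carrier G" and one: "\<one> \<in> H"
    and closed: "\<And>x y. x \<in> H \<Longrightarrow> y \<in> H \<Longrightarrow> x \<otimes> y \<in> H"
  shows "subgroup H G"
proof
  fix x assume x: "x \<in> H"
  have "inj_on (\<lambda>y. y \<otimes> x) H"
    using x sub by (intro inj_onI) (metis r_cancel subsetD)
  then have "(\<lambda>y. y \<otimes> x) ` H = H"
    using fin x closed by (intro endo_inj_surj) auto
  then obtain y where "y \<in> H" "y \<otimes> x = \<one>"
    using one by (metis imageE)
  then show "inv x \<in> H"
    using inv_equality[of y x] x sub by auto
qed (use sub one closed in auto)

lemma BijGroup_action: "group_action (BijGroup E) E (\<lambda>g. g)"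
  unfolding group_action_def group_hom_def group_hom_axioms_def
  by (auto simp: group_BijGroup hom_def)

section \<open>Rational periodic points of quotient varieties\<close>

text \<open>Finiteness makes \<open>G\<close> closed under inverses in the group of all bijections, so it does not
  matter whether \<open>aut_group N V\<close> is itself a group.\<close>

lemma aut_group_finite_subgroup_action:
  assumes "subgroup G (aut_group N V)" "finite G"
  shows "group_action ((aut_group N V)\<lparr>carrier := G\<rparr>) V (\<lambda>g. g)"
proof -
  have "subgroup G (BijGroup V)"
    using assms(2)
  proof (rule group.finite_closed_imp_subgroup[OF group_BijGroup])
    show "G \<subseteq> carrier (BijGroup V)"
      using subgroup.subset[OF assms(1)] by (auto simp: aut_group_def BijGroup_def)
    show "\<one>\<^bsub>BijGroup V\<^esub> \<in> G"
      using subgroup.one_closed[OF assms(1)] by (simp add: aut_group_def)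
    show "g \<otimes>\<^bsub>BijGroup V\<^esub> h \<in> G" if "g \<in> G" "h \<in> G" for g h
      using subgroup.m_closed[OF assms(1) that] by (simp add: aut_group_def)
  qed
  from group_action.induced_action[OF BijGroup_action this] show ?thesis
    by (simp add: aut_group_def)
qed

theorem theorem1p7:
  fixes V :: "'f::finite_field proj_point set"
    and \<phi> :: "'f proj_point \<Rightarrow> 'f proj_point"
    and G :: "('f proj_point \<Rightarrow> 'f proj_point) set"
    and N :: nat
    and M :: "('f proj_point \<Rightarrow> 'f proj_point) set \<Rightarrow> nat"
    and W :: "('f proj_point \<Rightarrow> 'f proj_point) set \<Rightarrow> 'f proj_point set"
    and \<pi> \<phi>' :: "('f proj_point \<Rightarrow> 'f proj_point) set \<Rightarrow> 'f proj_point \<Rightarrow> 'f proj_point"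
    and n :: "('f proj_point \<Rightarrow> 'f proj_point) set \<Rightarrow> int"
  defines "GG \<equiv> (aut_group N V)\<lparr>carrier := G\<rparr>"
  assumes V: "quasiprojective N V"
    and \<phi>: "is_morphism N V N V \<phi>"
    and G: "subgroup G (aut_group N V)" "finite G"
    and commutes: "\<And>g x. g \<in> G \<Longrightarrow> x \<in> V \<Longrightarrow> \<phi> (g x) = g (\<phi> x)"
    and quotients: "\<And>H. subgroup H GG \<Longrightarrow> is_quotient N V H (M H) (W H) (\<pi> H)"
    and induced: "\<And>H. subgroup H GG \<Longrightarrow> is_morphism (M H) (W H) (M H) (W H) (\<phi>' H)"
      "\<And>H x. subgroup H GG \<Longrightarrow> x \<in> V \<Longrightarrow> \<phi>' H (\<pi> H x) = \<pi> H (\<phi> x)"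
    and relation: "char_equiv_zero GG
      (\<lambda>g. \<Sum>H | subgroup H GG. of_int (n H) * subgroup_idem H g)"
  shows "(\<Sum>H | subgroup H GG.
            n H * int (card (periodic_points (\<phi>' H) (rational_points (W H))))) = 0"
proof -
  have carrier_GG [simp]: "carrier GG = G"
    by (simp add: GG_def)
  interpret act: group_action GG V "\<lambda>g. g"
    unfolding GG_def using G by (rule aut_group_finite_subgroup_action)
  interpret group GG
    using act.group_hom group_hom.axioms(1) by auto

  have G_morphism: "is_morphism N V N V g" if "g \<in> G" for g
    using subgroup.subset[OF G(1)] that by (auto simp: aut_group_def)
  have G_in_V: "g x \<in> V" if "g \<in> G" "x \<in> V" for g x
    using act.element_image[of g x "g x"] that by simp
  have G_frobenius: "frobenius (g x) = g (frobenius x)" if "g \<in> G" "x \<in> V" for g x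
    using is_morphism_frobenius[OF V G_morphism] that by simp
  have \<phi>_in_V: "\<phi> x \<in> V" if "x \<in> V" for x
    using \<phi> that by (auto simp: is_morphism_def)
  have iter_in_V: "(\<phi> ^^ k) x \<in> V" if "x \<in> V" for k x
    by (induction k) (use that \<phi>_in_V in auto)
  have iter_commutes: "(\<phi> ^^ k) (g x) = g ((\<phi> ^^ k) x)" if "g \<in> G" "x \<in> V" for k g x
    by (induction k) (use that commutes iter_in_V in auto)

  define S where "S = periodic_points \<phi> V"
  have S_V: "S \<subseteq> V"
    by (auto simp: S_def periodic_points_def)
  have S_stable: "g x \<in> S" if "g \<in> G" "x \<in> S" for g x
    using that iter_commutes[of g x] G_in_V[of g x] by (auto simp: S_def periodic_points_def)
  \<comment> \<open>For \<open>g\<close> in \<open>G\<close> the counted set lies in the set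
    \<open>?T\<close> below with \<open>H = G\<close>, which is shown to be finite, so
    \<open>card\<close> is a true count.\<close>
  define \<theta> where "\<theta> g = card {x \<in> S. frobenius x = g x}" for g

  have points: "periodic_points (\<phi>' H) (rational_points (W H))
      = \<pi> H ` {x \<in> S. frobenius x \<in> orbit (GG\<lparr>carrier := H\<rparr>) (\<lambda>g. g) x}" (is "?L = ?R")
    and count: "(\<Sum>h\<in>H. \<theta> h)
      = card H * card (periodic_points (\<phi>' H) (rational_points (W H)))"
    if H: "subgroup H GG" for H
  proof -
    have H_G: "H \<subseteq> G"
      using subgroup.subset[OF H] by simp
    note quot = quotients[OF H, unfolded is_quotient_def]
    note W = quot[THEN conjunct1] and \<pi> = quot[THEN conjunct2, THEN conjunct1]
      and \<pi>_surj = quot[THEN conjunct2, THEN conjunct2, THEN conjunct1]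
    have \<pi>_eq: "\<pi> H x = \<pi> H y \<longleftrightarrow> (\<exists>h\<in>H. y = h x)" if "x \<in> V" "y \<in> V" for x y
      using quot[THEN conjunct2, THEN conjunct2, THEN conjunct2, THEN conjunct1] that by (elim ballE) auto
    have \<pi>_frobenius: "\<pi> H (frobenius x) = frobenius (\<pi> H x)" if "x \<in> V" for x
      using V \<pi> that by (rule is_morphism_frobenius)
    have orbit_iff: "y \<in> orbit (GG\<lparr>carrier := H\<rparr>) (\<lambda>g. g) x \<longleftrightarrow> \<pi> H x = \<pi> H y"
      if "x \<in> V" "y \<in> V" for x y
      using \<pi>_eq[OF that] by (auto simp: orbit_def)
    \<comment> \<open>Frobenius passes through \<open>\<pi> H\<close>, and the fibres of
      \<open>\<pi> H\<close> are the \<open>H\<close>-orbits.\<close>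
    have rational_iff: "frobenius (\<pi> H x) = \<pi> H x \<longleftrightarrow>
        frobenius x \<in> orbit (GG\<lparr>carrier := H\<rparr>) (\<lambda>g. g) x" if "x \<in> V" for x
      using orbit_iff[OF that frobenius_in_quasiprojective[OF V that]] \<pi>_frobenius[OF that] by auto
    have iter_\<pi>: "(\<phi>' H ^^ k) (\<pi> H x) = \<pi> H ((\<phi> ^^ k) x)" if "x \<in> V" for k x
      by (induction k) (use that induced(2)[OF H] iter_in_V in auto)
    have periodic_iff: "(\<exists>k\<ge>1. (\<phi>' H ^^ k) (\<pi> H x) = \<pi> H x) \<longleftrightarrow> x \<in> S" if x: "x \<in> V" for x
    proof
      assume "\<exists>k\<ge>1. (\<phi>' H ^^ k) (\<pi> H x) = \<pi> H x"
      then obtain k where k: "k \<ge> 1" "\<pi> H x = \<pi> H ((\<phi> ^^ k) x)"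
        using iter_\<pi>[OF x] by auto
      then obtain h where h: "h \<in> H" "(\<phi> ^^ k) x = h x"
        using \<pi>_eq[OF x iter_in_V[OF x]] by blast
      \<comment> \<open>\<open>\<phi> ^^ k\<close> moves \<open>x\<close> by \<open>h\<close> and
        commutes with \<open>G\<close>; iterating it as often as the group order kills
        \<open>h\<close>.\<close>
      have "((\<phi> ^^ k) ^^ Coset.order GG) x = (h [^]\<^bsub>GG\<^esub> Coset.order GG) x"
        using iter_in_V iter_commutes x h H_G by (intro act.commuting_funpow_eq) auto
      also have "h [^]\<^bsub>GG\<^esub> Coset.order GG = \<one>\<^bsub>GG\<^esub>"
        using h H_G by (intro pow_order_eq_1) auto
      also have "\<one>\<^bsub>GG\<^esub> x = x"
        using x by (simp flip: act.id_eq_one)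
      finally have "(\<phi> ^^ (k * Coset.order GG)) x = x"
        by (simp add: funpow_mult mult.commute)
      moreover have "k * Coset.order GG \<ge> 1"
        using k order_gt_0_iff_finite G(2) by (simp add: Suc_le_eq)
      ultimately show "x \<in> S"
        using x unfolding S_def periodic_points_def by blast
    next
      assume "x \<in> S"
      then show "\<exists>k\<ge>1. (\<phi>' H ^^ k) (\<pi> H x) = \<pi> H x"
        using iter_\<pi>[OF x] by (auto simp: S_def periodic_points_def)
    qed
    show points: "?L = ?R"
    proof (intro equalityI subsetI)
      fix p assume p: "p \<in> ?L"
      then have "p \<in> W H"
        by (simp add: periodic_points_def rational_points_def)
      then obtain x where x: "x \<in> V" "p = \<pi> H x"
        using \<pi>_surj by (metis imageE)
      then show "p \<in> ?R"
        using p rational_iff[OF x(1)] periodic_iff[OF x(1)]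
        by (simp add: rational_points_eq_frobenius_fixed[OF W] periodic_points_def)
    next
      fix p assume "p \<in> ?R"
      then obtain x where x: "p = \<pi> H x" "x \<in> S"
          "frobenius x \<in> orbit (GG\<lparr>carrier := H\<rparr>) (\<lambda>g. g) x"
        by blast
      then have x_V: "x \<in> V"
        using S_V by blast
      then show "p \<in> ?L"
        using x rational_iff[OF x_V] periodic_iff[OF x_V] imageI[OF x_V, of "\<pi> H"]
        by (simp add: rational_points_eq_frobenius_fixed[OF W] periodic_points_def \<pi>_surj)
    qed

    interpret actH: group_action "GG\<lparr>carrier := H\<rparr>" V "\<lambda>g. g"
      using H by (rule act.induced_action)
    let ?T = "{x \<in> S. frobenius x \<in> orbit (GG\<lparr>carrier := H\<rparr>) (\<lambda>g. g) x}"
    have fin_H: "finite H"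
      using H_G G(2) by (rule finite_subset)
    \<comment> \<open>\<open>\<pi> H\<close> maps \<open>?T\<close> into the finitely many rational
      points of \<open>W H\<close>, and every point of \<open>?T\<close> is an
      \<open>H\<close>-translate of the representative chosen by \<open>inv_into\<close>.\<close>
    have "finite ?T"
    proof (rule finite_subset)
      have "\<pi> H ` ?T \<subseteq> rational_points (W H)"
        unfolding points[symmetric] by (auto simp: periodic_points_def)
      then have fin: "finite (\<pi> H ` ?T)"
        using finite_rational_points[OF W] by (rule finite_subset)
      show "finite (\<Union>y\<in>\<pi> H ` ?T. (\<lambda>h. h (inv_into ?T (\<pi> H) y)) ` H)"
        using fin fin_H by blast
      show "?T \<subseteq> (\<Union>y\<in>\<pi> H ` ?T. (\<lambda>h. h (inv_into ?T (\<pi> H) y)) ` H)"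
      proof
        fix x assume x: "x \<in> ?T"
        define x' where "x' = inv_into ?T (\<pi> H) (\<pi> H x)"
        have "x' \<in> ?T" "\<pi> H x' = \<pi> H x"
          using x unfolding x'_def by (auto intro!: inv_into_into f_inv_into_f simp del: mem_Collect_eq)
        then obtain h where "h \<in> H" "x = h x'"
          using x S_V \<pi>_eq[of x' x] by blast
        then show "x \<in> (\<Union>y\<in>\<pi> H ` ?T. (\<lambda>h. h (inv_into ?T (\<pi> H) y)) ` H)"
          using x unfolding x'_def by blast
      qed
    qed
    then have "(\<Sum>h\<in>carrier (GG\<lparr>carrier := H\<rparr>). card {x \<in> S. frobenius x = h x})
        = Coset.order (GG\<lparr>carrier := H\<rparr>) * card (\<pi> H ` ?T)"
      using fin_H S_V S_stable H_G G_frobenius frobenius_in_quasiprojective[OF V] orbit_iff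
      by (intro actH.sum_card_twisted_fixed_points) (auto simp: subset_iff)
    then show "(\<Sum>h\<in>H. \<theta> h) = card H * card (periodic_points (\<phi>' H) (rational_points (W H)))"
      by (simp add: \<theta>_def points Coset.order_def)
  qed

  define \<alpha> :: "_ \<Rightarrow> rat"
    where "\<alpha> g = (\<Sum>H | subgroup H GG. of_int (n H) * subgroup_idem H g)" for g
  have fin_subgroups: "finite {H. subgroup H GG}"
    using subgroup.subset by (intro finite_subset[OF _ finite_Pow_iff[THEN iffD2, OF G(2)]]) fastforce
  have "(\<Sum>g\<in>G. \<alpha> g * of_nat (\<theta> g)) = 0"
  proof (rule char_equiv_zero_sum_class_function[simplified])
    show "finite G" by fact
    show "char_equiv_zero GG \<alpha>"
      using relation by (simp add: \<alpha>_def[abs_def])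
    show "\<alpha> g = \<alpha> h"
      if gh: "g \<in> G" "h \<in> G" "generate GG {g} = generate GG {h}" for g h
    proof -
      \<comment> \<open>A subgroup contains an element exactly when it contains the cyclic group
        generated by it.\<close>
      have "g \<in> H \<longleftrightarrow> h \<in> H" if H: "subgroup H GG" for H
        using generate_subgroup_incl[OF _ H, of "{g}"] generate_subgroup_incl[OF _ H, of "{h}"]
          generate.incl[of g "{g}" GG] generate.incl[of h "{h}" GG] gh(3) by auto
      then show ?thesis
        by (simp add: \<alpha>_def subgroup_idem_def)
    qed
    show "of_nat (\<theta> (x \<otimes>\<^bsub>GG\<^esub> g \<otimes>\<^bsub>GG\<^esub> inv\<^bsub>GG\<^esub> x)) = (of_nat (\<theta> g) :: rat)"
      if g: "g \<in> G" and x: "x \<in> G" for g x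
    proof -
      define x' where "x' = inv\<^bsub>GG\<^esub> x"
      have inv_x: "x' \<in> G"
        using inv_closed[of x] x by (simp add: x'_def)
      have x_inv: "x (x' y) = y" "x' (x y) = y" if "y \<in> V" for y
        using act.orbit_sym_aux[of x y "x y"] act.orbit_sym_aux[of x' y "x' y"] x inv_x that
        by (auto simp: x'_def)
      have conj: "(x \<otimes>\<^bsub>GG\<^esub> g \<otimes>\<^bsub>GG\<^esub> x') y = x (g (x' y))" if "y \<in> V" for y
        using act.composition_rule g x inv_x that G_in_V m_closed[of x g] by simp
      \<comment> \<open>Translation by \<open>x\<close> preserves \<open>S\<close> and commutes with
        Frobenius, so it carries the points counted for \<open>g\<close> to those counted for its
        conjugate.\<close>
      have "bij_betw x {y \<in> S. frobenius y = g y}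
          {y \<in> S. frobenius y = (x \<otimes>\<^bsub>GG\<^esub> g \<otimes>\<^bsub>GG\<^esub> x') y}"
      proof (rule bij_betw_byWitness[where f' = "x'"])
        show "x ` {y \<in> S. frobenius y = g y}
            \<subseteq> {y \<in> S. frobenius y = (x \<otimes>\<^bsub>GG\<^esub> g \<otimes>\<^bsub>GG\<^esub> x') y}"
        proof clarify
          fix y assume y: "y \<in> S" "frobenius y = g y"
          then have "y \<in> V"
            using S_V by auto
          then show "x y \<in> S \<and> frobenius (x y) = (x \<otimes>\<^bsub>GG\<^esub> g \<otimes>\<^bsub>GG\<^esub> x') (x y)"
            using y x S_stable G_frobenius conj[OF G_in_V[OF x]] x_inv by simp
        qed
        show "x' ` {y \<in> S. frobenius y = (x \<otimes>\<^bsub>GG\<^esub> g \<otimes>\<^bsub>GG\<^esub> x') y}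
            \<subseteq> {y \<in> S. frobenius y = g y}"
        proof clarify
          fix y assume y: "y \<in> S" "frobenius y = (x \<otimes>\<^bsub>GG\<^esub> g \<otimes>\<^bsub>GG\<^esub> x') y"
          then have "y \<in> V"
            using S_V by auto
          then show "x' y \<in> S \<and> frobenius (x' y) = g (x' y)"
            using y inv_x g S_stable G_frobenius conj x_inv G_in_V by simp
        qed
      qed (use x_inv S_V in auto)
      then show ?thesis
        unfolding \<theta>_def x'_def[symmetric] by (simp add: bij_betw_same_card)
    qed
  qed
  also have "(\<Sum>g\<in>G. \<alpha> g * of_nat (\<theta> g))
      = (\<Sum>H | subgroup H GG. of_int (n H) * (\<Sum>g\<in>G. subgroup_idem H g * of_nat (\<theta> g)))"
    by (simp add: \<alpha>_def sum_distrib_right sum_distrib_left mult.assoc) (rule sum.swap)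
  also have "\<dots> = (\<Sum>H | subgroup H GG.
      of_int (n H) * of_nat (card (periodic_points (\<phi>' H) (rational_points (W H)))))"
  proof (intro sum.cong refl, clarify)
    fix H assume H: "subgroup H GG"
    have H_G: "H \<subseteq> G" and "H \<noteq> {}"
      using subgroup.subset[OF H] subgroup.one_closed[OF H] by auto
    then have "card H \<noteq> 0"
      using finite_subset[OF H_G G(2)] by simp
    \<comment> \<open>Pairing with the idempotent averages \<open>\<theta>\<close> over
      \<open>H\<close>, which \<open>count\<close> evaluates.\<close>
    have "(\<Sum>g\<in>G. subgroup_idem H g * of_nat (\<theta> g))
        = (\<Sum>h\<in>H. subgroup_idem H h * of_nat (\<theta> h))"
      using H_G G(2) by (intro sum.mono_neutral_right) (auto simp: subgroup_idem_def)
    also have "\<dots> = of_nat (\<Sum>h\<in>H. \<theta> h) / of_nat (card H)"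
      by (simp add: subgroup_idem_def sum_divide_distrib)
    also have "\<dots> = of_nat (card (periodic_points (\<phi>' H) (rational_points (W H))))"
      using \<open>card H \<noteq> 0\<close> by (simp only: count[OF H]) simp
    finally show "of_int (n H) * (\<Sum>g\<in>G. subgroup_idem H g * of_nat (\<theta> g))
        = (of_int (n H) * of_nat (card (periodic_points (\<phi>' H) (rational_points (W H)))) :: rat)"
      by simp
  qed
  also have "\<dots> = of_int (\<Sum>H | subgroup H GG.
      n H * int (card (periodic_points (\<phi>' H) (rational_points (W H)))))"
    by simp
  finally show ?thesis
    by (simp only: of_int_eq_0_iff)
qed

end
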